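(* Let $A\subset B$ and $B\subset C$ be two integral ring extensions of integral domains. If $\mathrm{d}_A(B)=\mu_A(B)$, then $$\mathrm{d}_A(C)\leq \mathrm{d}_A(B)\,\mathrm{d}_B(C).$$
   Context: All rings are commutative with unity. For an integral ring extension $A\subset B$ of integral domains and $b\in B$, the integral degree of $b$ over $A$, denoted $\mathrm{id}_A(b)$, is the minimum integer $n\geq 1$ such that $b$ is a root of a monic polynomial of degree $n$ in $A[T]$. The integral degree of $B$ over $A$ is $\mathrm{d}_A(B)=\sup\{\mathrm{id}_A(b)\mid b\in B\}$ (possibly $\infty$). $\mu_A(B)$ denotes the minimal number of generators of $B$ as an $A$-module (equal to $\infty$ if $B$ is not a finitely generated $A$-module). *)

theory Defs
  imports "HOL-Computational_Algebra.Polynomial" "HOL-Library.Extended_Nat"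
begin

text \<open>
  All rings are unital subrings, with common identity element, of an ambient integral domain
  given as a type of class \<^class>\<open>idom\<close>; they are therefore automatically integral domains.
\<close>

definition unital_subring :: "'a::idom set \<Rightarrow> bool" where
  "unital_subring A \<longleftrightarrow>
     1 \<in> A \<and> (\<forall>x\<in>A. \<forall>y\<in>A. x - y \<in> A) \<and> (\<forall>x\<in>A. \<forall>y\<in>A. x * y \<in> A)"

definition monic_equation :: "'a::idom set \<Rightarrow> 'a \<Rightarrow> nat \<Rightarrow> bool" where
  "monic_equation A b n \<longleftrightarrow>
     (\<exists>p. (\<forall>i. coeff p i \<in> A) \<and> lead_coeff p = 1 \<and> degree p = n \<and> poly p b = 0)"

definition integral_extension :: "'a::idom set \<Rightarrow> 'a set \<Rightarrow> bool" where
  "integral_extension A B \<longleftrightarrow>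
     unital_subring A \<and> unital_subring B \<and> A \<subseteq> B \<and> (\<forall>b\<in>B. \<exists>n. monic_equation A b n)"

text \<open>In \<^typ>\<open>enat\<close> the infimum of a nonempty set is its minimum; that of the empty set is \<open>\<infinity>\<close>.\<close>

definition elem_integral_degree :: "'a::idom set \<Rightarrow> 'a \<Rightarrow> enat" where
  "elem_integral_degree A b = Inf {enat n |n. n \<ge> 1 \<and> monic_equation A b n}"

definition integral_degree :: "'a::idom set \<Rightarrow> 'a set \<Rightarrow> enat" where
  "integral_degree A B = (SUP b\<in>B. elem_integral_degree A b)"

definition linear_combinations :: "'a::idom set \<Rightarrow> 'a set \<Rightarrow> 'a set" where
  "linear_combinations A S = {(\<Sum>s\<in>S. a s * s) |a. \<forall>s\<in>S. a s \<in> A}"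

definition min_generators :: "'a::idom set \<Rightarrow> 'a set \<Rightarrow> enat" where
  "min_generators A B =
     Inf {enat (card S) |S. finite S \<and> S \<subseteq> B \<and> linear_combinations A S = B}"

end

theory Submission
  imports Defs "Jordan_Normal_Form.Char_Poly"
begin

text \<open>
  If \<open>c\<close> satisfies a monic equation of degree \<open>m\<close> over \<open>B\<close> and \<open>B\<close> is generated by \<open>n\<close> elements
  over \<open>A\<close>, then \<open>B[c]\<close> is generated by \<open>n * m\<close> elements over \<open>A\<close>. By the determinant trick \<open>c\<close>
  then satisfies a monic equation of degree \<open>n * m\<close> over \<open>A\<close>, the characteristic polynomial of the
  matrix of multiplication by \<open>c\<close>. Hence
  \<open>id\<^sub>A(c) \<le> \<mu>\<^sub>A(B) * id\<^sub>B(c)\<close>, and the hypothesis replaces \<open>\<mu>\<^sub>A(B)\<close> by \<open>d\<^sub>A(B)\<close>.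
\<close>

section \<open>Closure of unital subrings under ring operations and determinants\<close>

lemma unital_subring_one: "unital_subring A \<Longrightarrow> 1 \<in> A"
  and unital_subring_diff: "unital_subring A \<Longrightarrow> x \<in> A \<Longrightarrow> y \<in> A \<Longrightarrow> x - y \<in> A"
  and unital_subring_mult: "unital_subring A \<Longrightarrow> x \<in> A \<Longrightarrow> y \<in> A \<Longrightarrow> x * y \<in> A"
  by (simp_all add: unital_subring_def)

lemma unital_subring_zero: "unital_subring A \<Longrightarrow> 0 \<in> A"
  using unital_subring_diff[of A 1 1] by (simp add: unital_subring_one)

lemma unital_subring_uminus: "unital_subring A \<Longrightarrow> x \<in> A \<Longrightarrow> - x \<in> A"
  using unital_subring_diff[of A 0 x] by (simp add: unital_subring_zero)

lemma unital_subring_add: "unital_subring A \<Longrightarrow> x \<in> A \<Longrightarrow> y \<in> A \<Longrightarrow> x + y \<in> A"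
  using unital_subring_diff[of A x "- y"] by (simp add: unital_subring_uminus)

lemma unital_subring_sum:
  assumes "unital_subring A" and "\<And>i. i \<in> I \<Longrightarrow> f i \<in> A"
  shows "sum f I \<in> A"
  using assms(2) by (induction I rule: infinite_finite_induct)
    (auto simp: unital_subring_zero[OF assms(1)] intro: unital_subring_add[OF assms(1)])

lemma unital_subring_prod:
  assumes "unital_subring A" and "\<And>i. i \<in> I \<Longrightarrow> f i \<in> A"
  shows "prod f I \<in> A"
  using assms(2) by (induction I rule: infinite_finite_induct)
    (auto simp: unital_subring_one[OF assms(1)] intro: unital_subring_mult[OF assms(1)])

text \<open>The Leibniz formula uses only sums, products and signs, and a sign costs at most one
  negation.\<close>

lemma unital_subring_det:
  assumes A: "unital_subring A" and M: "M \<in> carrier_mat n n"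
    and entries: "\<And>i j. i < n \<Longrightarrow> j < n \<Longrightarrow> M $$ (i, j) \<in> A"
  shows "det M \<in> A"
proof -
  have "M $$ (i, p i) \<in> A" if "p permutes {0..<n}" "i \<in> {0..<n}" for p i
    using that entries permutes_in_image[OF that(1), of i] by simp
  then have "signof p * (\<Prod>i = 0..<n. M $$ (i, p i)) \<in> A" if "p permutes {0..<n}" for p
    using that
    by (auto simp: sign_def intro!: unital_subring_prod[OF A] unital_subring_uminus[OF A])
  then show ?thesis
    by (auto simp: det_def'[OF M] intro!: unital_subring_sum[OF A])
qed

text \<open>Makes \<open>unital_subring_det\<close> applicable to the characteristic matrix, whose
  entries are polynomials.\<close>

lemma unital_subring_poly:
  assumes A: "unital_subring A"
  shows "unital_subring {p. \<forall>i. coeff p i \<in> A}"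
  unfolding unital_subring_def
  by (auto simp: coeff_mult unital_subring_one[OF A] unital_subring_zero[OF A]
      intro!: unital_subring_diff[OF A] unital_subring_mult[OF A] unital_subring_sum[OF A])

section \<open>Characteristic polynomials and the determinant trick\<close>

lemma coeff_char_poly_in_subring:
  assumes A: "unital_subring A" and M: "M \<in> carrier_mat n n"
    and entries: "\<And>i j. i < n \<Longrightarrow> j < n \<Longrightarrow> M $$ (i, j) \<in> A"
  shows "coeff (char_poly M) k \<in> A"
proof -
  have "char_poly M \<in> {p. \<forall>i. coeff p i \<in> A}"
    unfolding char_poly_def
  proof (rule unital_subring_det[OF unital_subring_poly[OF A] char_poly_matrix_closed[OF M]])
    fix i j assume ij: "i < n" "j < n"
    then show "char_poly_matrix M $$ (i, j) \<in> {p. \<forall>i. coeff p i \<in> A}"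
      using M entries[OF ij] unital_subring_zero[OF A] unital_subring_one[OF A]
      by (auto simp: char_poly_matrix_def coeff_pCons
          intro: unital_subring_uminus[OF A] split: nat.splits)
  qed
  then show ?thesis by simp
qed

text \<open>Evaluating the characteristic polynomial at \<open>c\<close> gives the determinant of
  \<open>c\<close> times the identity minus \<open>M\<close>. That matrix kills the nonzero vector
  \<open>v\<close>, so over a domain its determinant is 0.\<close>

lemma poly_char_poly_eq_0:
  fixes M :: "'a::idom mat"
  assumes M: "M \<in> carrier_mat n n" and v: "v \<in> carrier_vec n" "v \<noteq> 0\<^sub>v n"
    and eigen: "M *\<^sub>v v = c \<cdot>\<^sub>v v"
  shows "poly (char_poly M) c = 0"
proof -
  define N where "N = c \<cdot>\<^sub>m 1\<^sub>m n - M"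
  have N: "N \<in> carrier_mat n n"
    using M by (auto simp: N_def intro: minus_carrier_mat)
  have "N *\<^sub>v v = (c \<cdot>\<^sub>m 1\<^sub>m n) *\<^sub>v v - M *\<^sub>v v"
    unfolding N_def by (rule minus_mult_distrib_mat_vec) (use M v in auto)
  also have "(c \<cdot>\<^sub>m 1\<^sub>m n) *\<^sub>v v = c \<cdot>\<^sub>v v"
    by (rule eq_vecI) (use v in auto)
  also have "c \<cdot>\<^sub>v v - M *\<^sub>v v = 0\<^sub>v n"
    using v by (simp add: eigen)
  finally have "det N = 0"
    using det_0_iff_vec_prod_zero[OF N] v by blast
  moreover have "poly (char_poly M) c = det N"
    unfolding char_poly_def
    by (rule poly_det_cong[OF N char_poly_matrix_closed[OF M]])
      (use M in \<open>auto simp: char_poly_matrix_def N_def\<close>)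
  ultimately show ?thesis by simp
qed

text \<open>The family \<open>v\<close>, read as a vector, is an eigenvector for \<open>c\<close> of
  the matrix of coefficients from \<open>stable\<close>. In a domain one nonzero member suffices, in
  place of a faithful module.\<close>

lemma monic_equation_determinant_trick:
  fixes v :: "'i \<Rightarrow> 'a::idom"
  assumes A: "unital_subring A" and I: "finite I"
    and nonzero: "\<exists>i\<in>I. v i \<noteq> 0"
    and stable: "\<And>i. i \<in> I \<Longrightarrow> \<exists>a. (\<forall>j\<in>I. a j \<in> A) \<and> c * v i = (\<Sum>j\<in>I. a j * v j)"
  shows "monic_equation A c (card I)"
proof -
  define n where "n = card I"
  \<comment> \<open>Matrix indices are natural numbers, so \<open>I\<close> is enumerated by
    \<open>h\<close>.\<close>
  obtain h where h: "bij_betw h {0..<n} I"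
    using ex_bij_betw_nat_finite[OF I] by (auto simp: n_def)
  have hI: "h k \<in> I" if "k < n" for k
    using h that by (auto simp: bij_betw_def)
  obtain a where a: "\<And>i j. i \<in> I \<Longrightarrow> j \<in> I \<Longrightarrow> a i j \<in> A"
    and cv: "\<And>i. i \<in> I \<Longrightarrow> c * v i = (\<Sum>j\<in>I. a i j * v j)"
    using stable by metis
  define M where "M = mat n n (\<lambda>(k, l). a (h k) (h l))"
  define w where "w = vec n (\<lambda>k. v (h k))"
  have M: "M \<in> carrier_mat n n" and w: "w \<in> carrier_vec n"
    by (simp_all add: M_def w_def)
  have "w \<noteq> 0\<^sub>v n"
  proof
    assume "w = 0\<^sub>v n"
    then have "v (h k) = 0" if "k < n" for k
      using that by (metis index_vec index_zero_vec(1) w_def)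
    then show False
      using nonzero h by (auto simp: bij_betw_def)
  qed
  moreover have "M *\<^sub>v w = c \<cdot>\<^sub>v w"
  proof (rule eq_vecI)
    fix k assume "k < dim_vec (c \<cdot>\<^sub>v w)"
    then have k: "k < n" by (simp add: w_def)
    then have "(M *\<^sub>v w) $ k = (\<Sum>l = 0..<n. a (h k) (h l) * v (h l))"
      by (simp add: M_def w_def scalar_prod_def)
    also have "\<dots> = (\<Sum>j\<in>I. a (h k) j * v j)"
      by (rule sum.reindex_bij_betw[OF h])
    finally show "(M *\<^sub>v w) $ k = (c \<cdot>\<^sub>v w) $ k"
      using k by (simp add: w_def cv[OF hI[OF k]])
  qed (simp add: M_def w_def)
  ultimately have "poly (char_poly M) c = 0"
    using poly_char_poly_eq_0[OF M w] by simp
  moreover have "coeff (char_poly M) k \<in> A" for k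
    by (rule coeff_char_poly_in_subring[OF A M]) (simp add: M_def a hI)
  ultimately show ?thesis
    using degree_monic_char_poly[OF M] unfolding monic_equation_def n_def by metis
qed

section \<open>Monic equations and their transfer down a tower\<close>

lemma monic_equation_pos:
  assumes "monic_equation A b n"
  shows "n \<ge> 1"
proof (rule ccontr)
  assume "\<not> n \<ge> 1"
  \<comment> \<open>Degree 0 would leave the constant polynomial 1, which has no root.\<close>
  then obtain p where "degree p = 0" "lead_coeff p = 1" "poly p b = 0"
    using assms unfolding monic_equation_def by (metis less_one not_le)
  then show False
    by (auto elim!: degree_eq_zeroE)
qed

lemma monic_equation_power_eq:
  assumes B: "unital_subring B" and "monic_equation B c m"
  obtains b where "\<And>i. b i \<in> B" and "c ^ m = (\<Sum>i<m. b i * c ^ i)"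
proof -
  obtain p where p: "\<And>i. coeff p i \<in> B" "lead_coeff p = 1" "degree p = m" "poly p c = 0"
    using assms(2) by (auto simp: monic_equation_def)
  have "(\<Sum>i<m. coeff p i * c ^ i) + c ^ m = 0"
    using p by (simp add: poly_altdef lessThan_Suc_atMost[symmetric])
  then have "c ^ m = (\<Sum>i<m. - coeff p i * c ^ i)"
    by (simp add: sum_negf add_eq_0_iff)
  then show thesis
    using that[of "\<lambda>i. - coeff p i"] p(1) unital_subring_uminus[OF B] by blast
qed

text \<open>The determinant trick is applied to the products \<open>s * c ^ j\<close> with
  \<open>j < m\<close>. Indexing them by pairs keeps the count at \<open>card S * m\<close> even if
  some products coincide.\<close>

lemma monic_equation_tower:
  assumes A: "unital_subring A" and B: "unital_subring B"
    and S: "finite S" "S \<subseteq> B" "linear_combinations A S = B"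
    and c: "monic_equation B c m"
  shows "monic_equation A c (card S * m)"
proof -
  let ?v = "\<lambda>(s, j). s * c ^ j"
  obtain b where b: "\<And>i. b i \<in> B" "c ^ m = (\<Sum>i<m. b i * c ^ i)"
    using monic_equation_power_eq[OF B c] by metis
  \<comment> \<open>Every \<open>B\<close>-combination of the powers of \<open>c\<close> below
    \<open>m\<close> is an \<open>A\<close>-combination of the family: each coefficient is expanded
    in the generators \<open>S\<close>.\<close>
  have expand: "\<exists>a. (\<forall>x\<in>S \<times> {..<m}. a x \<in> A) \<and>
      (\<Sum>i<m. d i * c ^ i) = (\<Sum>x\<in>S \<times> {..<m}. a x * ?v x)"
    if d: "\<And>i. d i \<in> B" for d
  proof -
    have "\<exists>a. (\<forall>s\<in>S. a s \<in> A) \<and> d i = (\<Sum>s\<in>S. a s * s)" for i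
      using d[of i] S(3) by (auto simp: linear_combinations_def)
    then obtain a where a: "\<And>i s. s \<in> S \<Longrightarrow> a i s \<in> A" "\<And>i. d i = (\<Sum>s\<in>S. a i s * s)"
      by metis
    have "(\<Sum>i<m. d i * c ^ i) = (\<Sum>i<m. \<Sum>s\<in>S. a i s * (s * c ^ i))"
      by (simp add: a(2) sum_distrib_right mult.assoc)
    also have "\<dots> = (\<Sum>(s, i)\<in>S \<times> {..<m}. a i s * (s * c ^ i))"
      by (subst sum.swap) (rule sum.cartesian_product)
    finally show ?thesis
      using a(1) by (intro exI[of _ "\<lambda>(s, i). a i s"]) (auto simp: case_prod_unfold)
  qed
  have "monic_equation A c (card (S \<times> {..<m}))"
  proof (rule monic_equation_determinant_trick[OF A, where v = ?v])
    \<comment> \<open>Otherwise \<open>S\<close> would generate only 0, whereas \<open>B\<close>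
      contains 1.\<close>
    have "\<exists>s\<in>S. s \<noteq> 0"
    proof (rule ccontr)
      assume "\<not> (\<exists>s\<in>S. s \<noteq> 0)"
      then have "linear_combinations A S \<subseteq> {0}"
        by (auto simp: linear_combinations_def intro!: sum.neutral)
      then show False
        using S(3) unital_subring_one[OF B] by auto
    qed
    \<comment> \<open>Exponent 0 is available because \<open>m\<close> is at least 1.\<close>
    then show "\<exists>x\<in>S \<times> {..<m}. ?v x \<noteq> 0"
      using monic_equation_pos[OF c] by (force intro: bexI[of _ "(_, 0)"])
  next
    fix x assume "x \<in> S \<times> {..<m}"
    then obtain s j where x: "x = (s, j)" "s \<in> S" "j < m" by auto
    have s: "s \<in> B" using x(2) S(2) by blast
    \<comment> \<open>Coefficients of \<open>s * c ^ Suc j\<close> in the powers below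
      \<open>m\<close>: only for \<open>Suc j = m\<close> does the exponent leave the range, and
      then the equation for \<open>c ^ m\<close> reduces it.\<close>
    define d where "d i = (if Suc j = m then s * b i else if i = Suc j then s else 0)" for i
    have "c * ?v x = s * c ^ Suc j"
      by (simp add: x(1) algebra_simps)
    also have "\<dots> = (\<Sum>i<m. d i * c ^ i)"
    proof (cases "Suc j = m")
      case True
      then have "s * c ^ Suc j = s * (\<Sum>i<m. b i * c ^ i)"
        by (simp only: b(2))
      then show ?thesis
        using True by (simp add: d_def sum_distrib_left mult.assoc)
    next
      case False
      then have "(\<Sum>i<m. d i * c ^ i) = (\<Sum>i<m. if i = Suc j then s * c ^ i else 0)"
        by (intro sum.cong) (auto simp: d_def)
      then show ?thesis
        using False x(3) by simp
    qed
    finally have eq: "c * ?v x = (\<Sum>i<m. d i * c ^ i)" .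
    have "d i \<in> B" for i
      using s b(1) by (auto simp: d_def unital_subring_zero[OF B] intro: unital_subring_mult[OF B])
    from expand[of d, OF this]
    show "\<exists>a. (\<forall>y\<in>S \<times> {..<m}. a y \<in> A) \<and> c * ?v x = (\<Sum>y\<in>S \<times> {..<m}. a y * ?v y)"
      unfolding eq .
  qed (simp add: S(1))
  then show ?thesis
    by (simp add: card_cartesian_product)
qed

section \<open>Attained infima and the degree bound\<close>

lemma elem_integral_degree_le: "monic_equation A b n \<Longrightarrow> elem_integral_degree A b \<le> enat n"
  using monic_equation_pos unfolding elem_integral_degree_def by (blast intro: Inf_lower)

lemma elem_integral_degree_attained:
  assumes "monic_equation A b n"
  obtains m where "monic_equation A b m" and "elem_integral_degree A b = enat m"
proof -
  have "elem_integral_degree A b \<in> {enat n |n. n \<ge> 1 \<and> monic_equation A b n}"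
    unfolding elem_integral_degree_def
    by (rule wellorder_InfI[of "enat n"]) (use assms monic_equation_pos in auto)
  then show thesis
    using that by blast
qed

text \<open>A finite value rules out the empty set of candidates, whose infimum is
  \<open>\<infinity>\<close>; a nonempty infimum is attained by well-ordering.\<close>

lemma min_generators_attained:
  assumes "min_generators A B = enat n"
  obtains S where "finite S" "S \<subseteq> B" "linear_combinations A S = B" "card S = n"
proof -
  let ?X = "{enat (card S) |S. finite S \<and> S \<subseteq> B \<and> linear_combinations A S = B}"
  have "?X \<noteq> {}"
  proof
    assume "?X = {}"
    then have "min_generators A B = \<infinity>"
      unfolding min_generators_def by (simp only: Inf_empty top_enat_def)
    with assms show False by simp
  qed
  then have "Inf ?X \<in> ?X"
    by (meson all_not_in_conv wellorder_InfI)
  then show thesis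
    using assms that unfolding min_generators_def by auto
qed

theorem corollary3p4:
  fixes A B C :: "'a::idom set"
  assumes "integral_extension A B"
    and "integral_extension B C"
    and "integral_degree A B = min_generators A B"
  shows "integral_degree A C \<le> integral_degree A B * integral_degree B C"
  unfolding integral_degree_def[of A C]
proof (rule SUP_least)
  fix c assume c: "c \<in> C"
  have A: "unital_subring A" and B: "unital_subring B"
    using assms(1) by (auto simp: integral_extension_def)
  obtain k where "monic_equation B c k"
    using assms(2) c by (auto simp: integral_extension_def)
  then obtain m where m: "monic_equation B c m" "elem_integral_degree B c = enat m"
    by (rule elem_integral_degree_attained)
  have le: "enat m \<le> integral_degree B C"
    using c m(2) unfolding integral_degree_def by (metis SUP_upper)
  show "elem_integral_degree A c \<le> integral_degree A B * integral_degree B C"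
  proof (cases "min_generators A B")
    case (enat n)
    then obtain S where S: "finite S" "S \<subseteq> B" "linear_combinations A S = B" "card S = n"
      by (rule min_generators_attained)
    have "elem_integral_degree A c \<le> enat (n * m)"
      using elem_integral_degree_le[OF monic_equation_tower[OF A B S(1-3) m(1)]] S(4) by simp
    \<comment> \<open>The hypothesis trades the number of generators \<open>n\<close> for the
      integral degree.\<close>
    also have "\<dots> = integral_degree A B * enat m"
      using assms(3) enat by simp
    also have "\<dots> \<le> integral_degree A B * integral_degree B C"
      by (rule mult_left_mono[OF le]) simp
    finally show ?thesis .
  next
    case infinity
    \<comment> \<open>Since 0 times \<open>\<infinity>\<close> is 0 in \<open>enat\<close>, the
      bound is \<open>\<infinity>\<close> only once the second factor is known to be
      nonzero.\<close>
    have "integral_degree B C \<noteq> 0"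
      using le monic_equation_pos[OF m(1)] by (auto simp: zero_enat_def)
    then show ?thesis
      using assms(3) infinity by (auto simp: imult_infinity)
  qed
qed

end
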